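(* Let $n\geq 4$ be an integer, and let $(e_{1},e_{2},e_{3})$ be one of the triples $(1,2,3)$, $(1,2,4)$, $(-1,1,2)$. For each positive integer $k$ there are at least $k$ pairwise distinct $n$-tuples of integers having the same sum of $e$-th powers for each $e\in\{e_{1},e_{2},e_{3}\}$; that is, there are $k$ distinct $n$-tuples $(x_{1}^{(l)},\ldots,x_{n}^{(l)})\in\mathbb{Z}^{n}$, $l=1,\ldots,k$, such that for each $e\in\{e_{1},e_{2},e_{3}\}$ the value $\sum_{j=1}^{n}(x_{j}^{(l)})^{e}$ does not depend on $l$. Moreover, for any given positive integer $a$, these $n$-tuples can be chosen in such a way that their common sum $\sum_{j=1}^{n}x_{j}^{(l)}$ is divisible by $a$.
   Context: When the exponent $-1$ occurs, all entries of the $n$-tuples are required to be non-zero. *)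

theory Defs
  imports Complex_Main
begin

(* n-tuples are int lists of length n. power_sum e xs is the sum of the e-th powers of the
   entries; it takes values in rat since e may be -1. For e < 0 it is meaningful only when no
   entry is 0, because 0 powi e = 0. *)
definition power_sum :: "int \<Rightarrow> int list \<Rightarrow> rat" where
  "power_sum e xs = (\<Sum>t\<leftarrow>xs. rat_of_int t powi e)"

end

theory Submission imports Defs begin

text \<open>Conics with a rational point carry arbitrarily many integer points after scaling. On
  \<open>u\<^sup>2 + v\<^sup>2 = N\<close> the tuple \<open>(u, v, -v, -u)\<close> has vanishing odd power sums, including
  exponent \<open>-1\<close>, and sum of squares \<open>2 N\<close>. On \<open>u\<^sup>2 + u v + v\<^sup>2 = N\<close> the tuple
  \<open>(u, v, -u-v, 0)\<close> has power sums \<open>0\<close>, \<open>2 N\<close>, \<open>2 N\<^sup>2\<close> for the exponents \<open>1, 2, 4\<close>. Both are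
  padded with the constant \<open>a\<close>.\<close>

lemma power_sum_append: "power_sum e (xs @ ys) = power_sum e xs + power_sum e ys"
  by (simp add: power_sum_def)

text \<open>The lines through \<open>(-1, 0)\<close> parametrize \<open>x\<^sup>2 + c x y + y\<^sup>2 = 1\<close> by
  \<open>x = (m\<^sup>2 - 1) / (m\<^sup>2 + c m + 1)\<close>, \<open>y = (2 m + c) / (m\<^sup>2 + c m + 1)\<close>.\<close>
lemma many_points_on_conic:
  fixes c :: int and k :: nat
  assumes "c \<ge> 0"
  shows "\<exists>(u :: nat \<Rightarrow> int) v N. inj_on v {1..k} \<and>
    (\<forall>l\<in>{1..k}. (u l)\<^sup>2 + c * u l * v l + (v l)\<^sup>2 = N \<and> u l \<noteq> 0 \<and> v l \<noteq> 0)"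
proof -
  \<comment> \<open>The parameter starts at 2 because \<open>m = 1\<close> would give
    \<open>u = 0\<close>, which exponent -1 forbids.\<close>
  define m :: "nat \<Rightarrow> int" where "m l = int l + 1" for l
  define d where "d l = (m l)\<^sup>2 + c * m l + 1" for l
  \<comment> \<open>A common denominator: scaling all \<open>k\<close> rational points by
    \<open>D\<close> makes them integral and turns the constant 1 into \<open>D^2\<close>.\<close>
  define D where "D = (\<Prod>l\<in>{1..k}. d l)"
  define q where "q l = D div d l" for l
  define u where "u l = q l * ((m l)\<^sup>2 - 1)" for l
  define v where "v l = q l * (2 * m l + c)" for l
  have m2: "m l \<ge> 2" if "l \<in> {1..k}" for l
    using that by (simp add: m_def)
  have dpos: "d l > 0" for l
  proof -
    have "c * m l \<ge> 0" using assms by (simp add: m_def)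
    then show ?thesis using zero_le_power2[of "m l"] unfolding d_def by linarith
  qed
  have Dpos: "D > 0"
    unfolding D_def using dpos by (simp add: prod_pos)
  have qd: "q l * d l = D" if "l \<in> {1..k}" for l
    unfolding q_def using that by (simp add: D_def dvd_prodI)
  have q0: "q l \<noteq> 0" if "l \<in> {1..k}" for l
    using qd[OF that] Dpos by auto
  have eq: "(u l)\<^sup>2 + c * u l * v l + (v l)\<^sup>2 = D\<^sup>2" if "l \<in> {1..k}" for l
  proof -
    have "(u l)\<^sup>2 + c * u l * v l + (v l)\<^sup>2 = (q l * d l)\<^sup>2"
      unfolding u_def v_def d_def by algebra
    then show ?thesis using qd[OF that] by simp
  qed
  have unz: "u l \<noteq> 0" if "l \<in> {1..k}" for l
  proof -
    have "m l * m l \<ge> 2 * 2" by (rule mult_mono) (use m2[OF that] in auto)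
    then show ?thesis using q0[OF that] by (simp add: u_def power2_eq_square)
  qed
  have vnz: "v l \<noteq> 0" if "l \<in> {1..k}" for l
    using m2[OF that] q0[OF that] assms by (simp add: v_def)
  have inj: "inj_on v {1..k}"
  proof (rule inj_onI)
    fix i j assume i: "i \<in> {1..k}" and j: "j \<in> {1..k}" and vv: "v i = v j"
    have "D * ((2 * m i + c) * d j) = (v i * d i) * d j"
      unfolding v_def qd[OF i, symmetric] by algebra
    also have "\<dots> = D * ((2 * m j + c) * d i)"
      unfolding vv unfolding v_def qd[OF j, symmetric] by algebra
    finally have "(2 * m i + c) * d j = (2 * m j + c) * d i"
      using Dpos by simp
    \<comment> \<open>The cross-multiplied difference of the \<open>y\<close>-coordinates splits off
      \<open>m j - m i\<close>; the cofactor is positive since \<open>m i * m j\<close> is at least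
      4.\<close>
    then have "(m j - m i) * (2 * (m i * m j) + c * (m i + m j) + c * c - 2) = 0"
      unfolding d_def by algebra
    moreover have "2 * (m i * m j) + c * (m i + m j) + c * c - 2 > 0"
    proof -
      have "m i * m j \<ge> 2 * 2" by (rule mult_mono) (use m2[OF i] m2[OF j] in auto)
      moreover have "c * (m i + m j) \<ge> 0" "c * c \<ge> 0"
        using m2[OF i] m2[OF j] assms by auto
      ultimately show ?thesis by linarith
    qed
    ultimately have "m i = m j" by auto
    then show "i = j" by (simp add: m_def)
  qed
  show ?thesis
    using eq unz vnz inj by (intro exI[of _ u] exI[of _ v] exI[of _ "D\<^sup>2"]) blast
qed

lemma power_sum_symmetric_tuple:
  fixes u v :: int
  shows "power_sum (-1) [u, v, -v, -u] = 0" "power_sum 1 [u, v, -v, -u] = 0"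
    "power_sum 2 [u, v, -v, -u] = of_int (2 * (u\<^sup>2 + v\<^sup>2))"
    "power_sum 3 [u, v, -v, -u] = 0"
  by (simp_all add: power_sum_def power_int_minus)

text \<open>Three numbers with sum 0 satisfy \<open>p4 = p2^2 / 2\<close> by Newton's identities, so
  fixing the quadratic form fixes exponent 4 as well.\<close>

lemma power_sum_zero_sum_tuple:
  fixes u v :: int
  shows "power_sum 1 [u, v, -u-v, 0] = 0"
    "power_sum 2 [u, v, -u-v, 0] = of_int (2 * (u\<^sup>2 + u * v + v\<^sup>2))"
    "power_sum 4 [u, v, -u-v, 0] = of_int (2 * (u\<^sup>2 + u * v + v\<^sup>2)\<^sup>2)"
proof -
  show "power_sum 1 [u, v, -u-v, 0] = 0" by (simp add: power_sum_def)
  show "power_sum 2 [u, v, -u-v, 0] = of_int (2 * (u\<^sup>2 + u * v + v\<^sup>2))"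
    by (simp add: power_sum_def) algebra
  show "power_sum 4 [u, v, -u-v, 0] = of_int (2 * (u\<^sup>2 + u * v + v\<^sup>2)\<^sup>2)"
    by (simp add: power_sum_def) algebra
qed

theorem corollary3p4:
  fixes n k :: nat and a :: int and e1 e2 e3 :: int
  assumes "n \<ge> 4"
    and "(e1, e2, e3) \<in> {(1, 2, 3), (1, 2, 4), (-1, 1, 2)}"
    and "k > 0"
    and "a > 0"
  shows "\<exists>x :: nat \<Rightarrow> int list.
           (\<forall>l\<in>{1..k}. length (x l) = n) \<and>
           inj_on x {1..k} \<and>
           (-1 \<in> {e1, e2, e3} \<longrightarrow> (\<forall>l\<in>{1..k}. 0 \<notin> set (x l))) \<and>
           (\<forall>e\<in>{e1, e2, e3}. \<forall>l\<in>{1..k}. \<forall>m\<in>{1..k}. power_sum e (x l) = power_sum e (x m)) \<and>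
           (\<forall>l\<in>{1..k}. a dvd sum_list (x l))"
proof (cases "e3 = 4")
  case True
  then have e: "e1 = 1" "e2 = 2" "e3 = 4" using assms(2) by auto
  \<comment> \<open>The conic with \<open>c = 1\<close>.\<close>
  obtain u v N where inj: "inj_on v {1..k}"
    and pts: "\<forall>l\<in>{1..k}. (u l)\<^sup>2 + u l * v l + (v l)\<^sup>2 = (N :: int)"
    using many_points_on_conic[OF zero_le_one, of k, unfolded mult_1] by blast
  note uv = bspec[OF pts]
  define x where "x l = [u l, v l, - u l - v l, 0] @ replicate (n - 4) a" for l
  have "power_sum e' (x l) = power_sum e' (x m)"
    if "e' \<in> {1, 2, 4}" "l \<in> {1..k}" "m \<in> {1..k}" for e' l m
    using that(1) unfolding x_def power_sum_append
    by (auto simp only: insert_iff empty_iff power_sum_zero_sum_tuple uv[OF that(2)] uv[OF that(3)])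
  moreover have "inj_on x {1..k}"
    \<comment> \<open>Entry 1 of \<open>x l\<close> is \<open>v l\<close>, so injectivity of
      \<open>v\<close> passes to \<open>x\<close>.\<close>
    by (rule inj_on_imageI2[where f' = "\<lambda>xs. xs ! 1"])
      (use inj in \<open>simp add: x_def comp_def\<close>)
  moreover have "length (x l) = n" "a dvd sum_list (x l)" for l
    using assms(1) by (simp_all add: x_def sum_list_replicate)
  moreover have "-1 \<notin> {1, 2, 4 :: int}" by simp
  ultimately show ?thesis
    unfolding e by (intro exI[of _ x]) blast
next
  case False
  \<comment> \<open>One family, on the circle \<open>c = 0\<close>, serves both remaining
    triples.\<close>
  then have e: "{e1, e2, e3} \<subseteq> {-1, 1, 2, 3}" using assms(2) by auto
  obtain u v N where inj: "inj_on v {1..k}"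
    and pts: "\<forall>l\<in>{1..k}. (u l)\<^sup>2 + (v l)\<^sup>2 = (N :: int)"
    and nz: "\<And>l. l \<in> {1..k} \<Longrightarrow> u l \<noteq> 0 \<and> v l \<noteq> 0"
    using many_points_on_conic[OF order_refl, of k, unfolded mult_zero_left add_0_right] by blast
  note uv = bspec[OF pts]
  \<comment> \<open>The padding adds \<open>(n - 4) * a\<close> to the sum 0 and, as
    \<open>a > 0\<close>, brings in no zero entry.\<close>
  define x where "x l = [u l, v l, - v l, - u l] @ replicate (n - 4) a" for l
  have same: "power_sum e' (x l) = power_sum e' (x m)"
    if "e' \<in> {-1, 1, 2, 3}" "l \<in> {1..k}" "m \<in> {1..k}" for e' l m
    using that(1) unfolding x_def power_sum_append
    by (auto simp only: insert_iff empty_iff power_sum_symmetric_tuple uv[OF that(2)] uv[OF that(3)])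
  have inj_x: "inj_on x {1..k}"
    by (rule inj_on_imageI2[where f' = "\<lambda>xs. xs ! 1"])
      (use inj in \<open>simp add: x_def comp_def\<close>)
  have len: "length (x l) = n" and dvd: "a dvd sum_list (x l)" for l
    using assms(1) by (simp_all add: x_def sum_list_replicate)
  have nonzero: "0 \<notin> set (x l)" if "l \<in> {1..k}" for l
    using nz[OF that] assms(4) by (auto simp: x_def)
  show ?thesis
    by (intro exI[of _ x] conjI impI ballI len inj_x nonzero same subsetD[OF e] dvd)
qed

end
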